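(* Let $(X,d)$ be a complete metric space and let $T:X\to \mathcal{CL}(X)$ be a multi-valued operator. Suppose that: (i) $T$ is a $(1,r)$-contractive multi-valued operator (for some $r\in[0,1)$); (ii) $SFix(T)\neq\emptyset$. Then there exists $z\in X$ such that: (a) $Fix(T)=SFix(T)=\{z\}$; (b) the fixed point problem is well-posed for $T$ with respect to $\mathcal{H}$.
   Context: Let $(X,d)$ be a metric space. $\mathcal{CL}(X)$ denotes the set of all nonempty closed subsets of $X$. For $x\in X$ and nonempty $A\subseteq X$, $D(x,A)=d(x,A)=\inf\{d(x,y): y\in A\}$. For nonempty closed $A,B\subseteq X$, the (generalized) Pompeiu-Hausdorff distance is $$\mathcal{H}(A,B)=\max\Big\{\sup_{x\in B}d(x,A),\ \sup_{x\in A}d(x,B)\Big\},$$ which takes values in $[0,\infty]$ (it is finite when $A,B$ are bounded). For a point $x$, $\mathcal{H}(x,A)$ means $\mathcal{H}(\{x\},A)$. For a multi-valued operator $T:X\to\mathcal{CL}(X)$: $Fix(T)=\{x\in X: x\in Tx\}$ is the set of fixed points, and $SFix(T)=\{x\in X: Tx=\{x\}\}$ is the set of strict fixed points (endpoints). $(s,r)$-contractive: $T$ is called an $(s,r)$-contractive multi-valued operator if $r\in[0,1)$, $s\geq r$, and for every $x,y\in X$, $$D(y,Tx)\leq s\, d(y,x)\quad\text{implies}\quad \mathcal{H}(Tx,Ty)\leq r\,\mathcal{M}_T(x,y),$$ where $$\mathcal{M}_T(x,y)=\max\left\{d(x,y),\ D(x,Tx),\ D(y,Ty),\ \frac{D(x,Ty)+D(y,Tx)}{2}\right\}.$$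 Well-posedness: the fixed point problem is well-posed for $T$ with respect to $\mathcal{H}$ if (1) $SFix(T)=\{z\}$ for some $z\in X$; and (2) whenever $(x_n)_{n\in\mathbb{N}}$ is a sequence in $X$ with $\mathcal{H}(x_n,Tx_n)\to 0$ as $n\to\infty$, then $d(x_n,z)\to 0$ as $n\to\infty$. *)

theory Defs
  imports "HOL-Analysis.Analysis"
begin

text \<open>
  The metric space X is a type of class \<^class>\<open>metric_space\<close>, and D(x,A) is the library's
  \<^const>\<open>infdist\<close>, which agrees with the infimum of distances for nonempty A.
\<close>

definition CL :: "'a::metric_space set set" where
  "CL = {A. A \<noteq> {} \<and> closed A}"

text \<open>
  The distance is extended-valued, since members of \<^const>\<open>CL\<close> may be unbounded.
  It is meant for nonempty arguments only.
\<close>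

definition hausdorff_dist :: "'a::metric_space set \<Rightarrow> 'a set \<Rightarrow> ennreal" where
  "hausdorff_dist A B =
     max (SUP x\<in>B. ennreal (infdist x A)) (SUP x\<in>A. ennreal (infdist x B))"

definition Fix :: "('a \<Rightarrow> 'a set) \<Rightarrow> 'a set" where
  "Fix T = {x. x \<in> T x}"

definition SFix :: "('a \<Rightarrow> 'a set) \<Rightarrow> 'a set" where
  "SFix T = {x. T x = {x}}"

definition contr_max :: "('a::metric_space \<Rightarrow> 'a set) \<Rightarrow> 'a \<Rightarrow> 'a \<Rightarrow> real" where
  "contr_max T x y =
     Max {dist x y, infdist x (T x), infdist y (T y),
          (infdist x (T y) + infdist y (T x)) / 2}"

definition sr_contractive :: "real \<Rightarrow> real \<Rightarrow> ('a::metric_space \<Rightarrow> 'a set) \<Rightarrow> bool" where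
  "sr_contractive s r T \<longleftrightarrow>
     0 \<le> r \<and> r < 1 \<and> r \<le> s \<and>
     (\<forall>x y. infdist y (T x) \<le> s * dist y x \<longrightarrow>
        hausdorff_dist (T x) (T y) \<le> ennreal (r * contr_max T x y))"

definition well_posed :: "('a::metric_space \<Rightarrow> 'a set) \<Rightarrow> bool" where
  "well_posed T \<longleftrightarrow>
     (\<exists>z. SFix T = {z} \<and>
        (\<forall>u :: nat \<Rightarrow> 'a. (\<lambda>n. hausdorff_dist {u n} (T (u n))) \<longlonglongrightarrow> 0 \<longrightarrow>
           (\<lambda>n. dist (u n) z) \<longlonglongrightarrow> 0))"

end

theory Submission
  imports Defs
begin

text \<open>
  Everything follows from one error bound.  At a strict fixed point \<open>z\<close> the premise
  of the contractive condition, with \<open>s = 1\<close> and \<open>x = z\<close>, reads \<open>dist y z \<le> dist y z\<close>, so the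
  contraction inequality is available for every \<open>y\<close>.  It says that all of \<open>T y\<close> lies
  within \<open>r * (dist y z + infdist y (T y))\<close> of \<open>z\<close>.  Going from \<open>y\<close> to \<open>z\<close> through a nearly
  closest point of \<open>T y\<close> therefore gives
  \<open>(1 - r) * dist y z \<le> (1 + r) * infdist y (T y)\<close> (lemma \<open>dist_strict_fixed_point_le\<close>):
  the displacement of \<open>y\<close> controls its distance to \<open>z\<close>.

  A fixed point has displacement \<open>0\<close>, hence equals \<open>z\<close>; and the displacement is at most
  the Hausdorff distance between \<open>{y}\<close> and \<open>T y\<close>, so a sequence along which the latter
  tends to \<open>0\<close> converges to \<open>z\<close>.
\<close>

lemma infdist_le_hausdorff_dist:
  assumes "x \<in> A"
  shows "ennreal (infdist x B) \<le> hausdorff_dist A B"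
  unfolding hausdorff_dist_def
  by (rule max.coboundedI2) (rule SUP_upper[OF assms])

lemma hausdorff_dist_commute: "hausdorff_dist A B = hausdorff_dist B A"
  by (simp add: hausdorff_dist_def max.commute)

lemma infdist_triangle_right:
  assumes "A \<noteq> {}" and "\<And>w. w \<in> A \<Longrightarrow> dist w z \<le> c"
  shows "dist y z \<le> infdist y A + c"
proof -
  have "dist y z - c \<le> infdist y A"
    unfolding infdist_notempty[OF assms(1)]
  proof (rule cINF_greatest[OF assms(1)])
    fix w assume "w \<in> A"
    then show "dist y z - c \<le> dist y w"
      using assms(2)[of w] dist_triangle[of y z w] by linarith
  qed
  then show ?thesis by linarith
qed

text \<open>
  The fourth entry of the maximum is absorbed because \<open>z\<close> is no farther from \<open>T y\<close> than
  \<open>dist y z + infdist y (T y)\<close>; the second one vanishes, \<open>z\<close> being fixed.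
\<close>

lemma contr_max_strict_fixed_point_le:
  assumes "T z = {z}"
  shows "contr_max T z y \<le> dist y z + infdist y (T y)"
proof -
  have "infdist z (T y) \<le> dist y z + infdist y (T y)"
    using infdist_triangle[of z "T y" y] by (simp add: dist_commute)
  then show ?thesis
    using infdist_nonneg[of y "T y"] zero_le_dist[of y z]
    by (simp add: contr_max_def assms dist_commute)
qed

lemma dist_image_strict_fixed_point_le:
  assumes "sr_contractive 1 r T" and "T z = {z}" and "w \<in> T y"
  shows "dist w z \<le> r * (dist y z + infdist y (T y))"
proof -
  have r: "0 \<le> r" 
    and contr: "infdist y (T z) \<le> 1 * dist y z \<Longrightarrow>
      hausdorff_dist (T z) (T y) \<le> ennreal (r * contr_max T z y)"
    using assms(1) by (auto simp: sr_contractive_def)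
  have "ennreal (dist w z) \<le> hausdorff_dist (T z) (T y)"
    using infdist_le_hausdorff_dist[OF assms(3), of "{z}"]
    by (simp add: assms(2) hausdorff_dist_commute)
  also have "\<dots> \<le> ennreal (r * contr_max T z y)"
    by (rule contr) (simp add: assms(2))
  also have "\<dots> \<le> ennreal (r * (dist y z + infdist y (T y)))"
    by (intro ennreal_leI mult_left_mono contr_max_strict_fixed_point_le r assms(2))
  finally show ?thesis
    using r by (simp add: infdist_nonneg)
qed

lemma dist_strict_fixed_point_le:
  assumes "sr_contractive 1 r T" and "T z = {z}" and "T y \<noteq> {}"
  shows "dist y z \<le> (1 + r) / (1 - r) * infdist y (T y)"
proof -
  have "r < 1" using assms(1) by (simp add: sr_contractive_def)
  have "dist y z \<le> infdist y (T y) + r * (dist y z + infdist y (T y))"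
    by (rule infdist_triangle_right[OF assms(3)])
      (rule dist_image_strict_fixed_point_le[OF assms(1,2)])
  then have "(1 - r) * dist y z \<le> (1 + r) * infdist y (T y)"
    by (simp add: algebra_simps)
  then show ?thesis
    using \<open>r < 1\<close> by (simp add: field_simps)
qed

lemma tendsto_infdist_if_hausdorff_dist:
  assumes "((\<lambda>n. hausdorff_dist {u n} (A n)) \<longlongrightarrow> 0) F"
  shows "((\<lambda>n. infdist (u n) (A n)) \<longlongrightarrow> 0) F"
proof -
  have "((\<lambda>n. ennreal (infdist (u n) (A n))) \<longlongrightarrow> ennreal 0) F"
    using tendsto_sandwich[OF _ _ tendsto_const assms]
    by (simp add: infdist_le_hausdorff_dist)
  then show ?thesis
    by (rule tendsto_ennrealD) (simp_all add: infdist_nonneg)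
qed

theorem theorem2p1:
  fixes T :: "'a::complete_space \<Rightarrow> 'a set" and r :: real
  assumes "\<And>x. T x \<in> CL"
    and "sr_contractive 1 r T"
    and "SFix T \<noteq> {}"
  shows "\<exists>z. Fix T = {z} \<and> SFix T = {z} \<and> well_posed T"
proof -
  obtain z where z: "T z = {z}" using assms(3) by (auto simp: SFix_def)
  have bound: "dist y z \<le> (1 + r) / (1 - r) * infdist y (T y)" for y
    using dist_strict_fixed_point_le[OF assms(2) z] assms(1)[of y] by (simp add: CL_def)
  have unique: "y = z" if "y \<in> T y" for y
    using bound[of y] that by simp
  have Fix: "Fix T = {z}"
    using unique z by (auto simp: Fix_def)
  have SFix: "SFix T = {z}"
    using unique z by (auto simp: SFix_def)
  have "(\<lambda>n. dist (u n) z) \<longlonglongrightarrow> 0"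
    if "(\<lambda>n. hausdorff_dist {u n} (T (u n))) \<longlonglongrightarrow> 0" for u :: "nat \<Rightarrow> 'a"
  proof (rule tendsto_sandwich[OF _ _ tendsto_const])
    show "(\<lambda>n. (1 + r) / (1 - r) * infdist (u n) (T (u n))) \<longlonglongrightarrow> 0"
      by (rule tendsto_mult_right_zero) (rule tendsto_infdist_if_hausdorff_dist[OF that])
  qed (simp_all only: bound zero_le_dist eventually_True)
  then have "well_posed T"
    using SFix by (auto simp: well_posed_def)
  with Fix SFix show ?thesis by blast
qed

end
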